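(* Let $(\mathfrak{g}, \mathfrak{h}, \rho, \psi)$ be a matched pair of Lie algebras and $(V, W, \alpha, \beta)$ be a representation of it. Equip $\mathfrak{g}\ltimes V := \mathfrak{g}\oplus V$ and $\mathfrak{h}\ltimes W:=\mathfrak{h}\oplus W$ with the semidirect product brackets $$[(x,u),(y,v)] := ([x,y]_\mathfrak{g}, (\rho_V)_x v - (\rho_V)_y u),\qquad [(h,w),(k,w')] := ([h,k]_\mathfrak{h}, (\psi_W)_h w' - (\psi_W)_k w).$$ Then the quadruple $(\mathfrak{g} \ltimes V, \mathfrak{h} \ltimes W, \rho \ltimes \alpha, \psi \ltimes \beta)$ is a matched pair of Lie algebras, where the maps $\rho \ltimes \alpha : (\mathfrak{g} \oplus V) \times (\mathfrak{h} \oplus W) \to \mathfrak{h} \oplus W$ and $\psi \ltimes \beta : (\mathfrak{h} \oplus W) \times (\mathfrak{g} \oplus V) \to \mathfrak{g} \oplus V$ are given by $$(\rho \ltimes \alpha)_{(x, v)} (h, w) := ( \rho_x h , (\rho_W)_x w + \alpha_v h ),\qquad (\psi \ltimes \beta)_{(h, w)} (x, u) := ( \psi_h x , (\psi_V)_h u + \beta_w x).$$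
   Context: All vector spaces and (multi)linear maps are over a field $\mathbf{k}$ of characteristic zero. A matched pair of Lie algebras is a quadruple $(\mathfrak{g}, \mathfrak{h}, \rho, \psi)$ with $\mathfrak{g},\mathfrak{h}$ Lie algebras and bilinear maps $\rho : \mathfrak{g} \times \mathfrak{h} \to \mathfrak{h}$, $(x,h)\mapsto\rho_x h$, and $\psi : \mathfrak{h} \times \mathfrak{g} \to \mathfrak{g}$, $(h,x)\mapsto \psi_h x$, such that $\rho$ is a representation of the Lie algebra $\mathfrak{g}$ on $\mathfrak{h}$, $\psi$ is a representation of the Lie algebra $\mathfrak{h}$ on $\mathfrak{g}$, and for all $x,y\in\mathfrak{g}$, $h,k\in\mathfrak{h}$: $$\rho_x ([h, k]_\mathfrak{h}) = [\rho_x h , k]_\mathfrak{h} + [h, \rho_x k]_\mathfrak{h} + \rho_{\psi_k x} h - \rho_{\psi_h x} k,$$ $$\psi_h ([x, y]_\mathfrak{g}) = [\psi_h x , y]_\mathfrak{g} + [x, \psi_h y]_\mathfrak{g} + \psi_{\rho_y h} x - \psi_{\rho_x h} y.$$ A representation of $(\mathfrak{g}, \mathfrak{h}, \rho, \psi)$ is a quadruple $(V,W,\alpha,\beta)$ in which $V$ is a representation of both $\mathfrak{g}$ and $\mathfrak{h}$ (actions $\rho_V:\mathfrak{g}\times V\to V$, $\psi_V:\mathfrak{h}\times V\to V$), $W$ is a representation of both $\mathfrak{g}$ and $\mathfrak{h}$ (actions $\rho_W:\mathfrak{g}\times W\to W$, $\psi_W:\mathfrak{h}\times W\to W$), and $\alpha: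 V \times \mathfrak{h} \to W$, $(v,h)\mapsto\alpha_v h$, $\beta: W \times \mathfrak{g} \to V$, $(w,x)\mapsto\beta_w x$, are bilinear maps such that for all $x,y\in\mathfrak{g}$, $h,k\in\mathfrak{h}$, $v\in V$, $w\in W$: $$\alpha_{ (\rho_V)_x v} h = (\rho_W)_x \alpha_v h - \alpha_v \rho_x h,\qquad \beta_{ (\psi_W)_h w} x = (\psi_V)_h \beta_w x - \beta_w \psi_h x,$$ $$(\rho_W)_x (\psi_W)_h w = (\psi_W)_{\rho_x h} w + (\psi_W)_h (\rho_W)_x w + \alpha_{\beta_w x} h - (\rho_W)_{\psi_h x} w,$$ $$\alpha_v [h, k]_\mathfrak{h} = - (\psi_W)_k \alpha_v h + (\psi_W)_h \alpha_v k + \alpha_{ (\psi_V)_k v} h - \alpha_{ (\psi_V)_h v} k,$$ $$(\psi_V)_h (\rho_V)_x v = (\rho_V)_{\psi_h x} v + (\rho_V)_x (\psi_V)_h v + \beta_{\alpha_v h} x - (\psi_V)_{\rho_x h} v,$$ $$\beta_w [x, y]_\mathfrak{g} = - (\rho_V)_y \beta_w x + (\rho_V)_x \beta_w y + \beta_{ (\rho_W)_y w} x - \beta_{ (\rho_W)_x w } y.$$ *)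

theory Defs
  imports "HOL-Analysis.Product_Vector"
begin

definition bilinear_map ::
  "('k::field \<Rightarrow> 'a::ab_group_add \<Rightarrow> 'a) \<Rightarrow> ('k \<Rightarrow> 'b::ab_group_add \<Rightarrow> 'b) \<Rightarrow>
   ('k \<Rightarrow> 'c::ab_group_add \<Rightarrow> 'c) \<Rightarrow> ('a \<Rightarrow> 'b \<Rightarrow> 'c) \<Rightarrow> bool" where
  "bilinear_map s1 s2 s3 f \<longleftrightarrow>
     (\<forall>y. Vector_Spaces.linear s1 s3 (\<lambda>x. f x y)) \<and>
     (\<forall>x. Vector_Spaces.linear s2 s3 (\<lambda>y. f x y))"

(* Vector spaces are whole types 'a::ab_group_add with an explicit scalar
   multiplication; the ground field 'k is shared between all of them. *)
locale lie_algebra = vector_space s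
  for s :: "'k::field \<Rightarrow> 'g::ab_group_add \<Rightarrow> 'g" +
  fixes br :: "'g \<Rightarrow> 'g \<Rightarrow> 'g"
  assumes bilinear_br: "bilinear_map s s s br"
    and br_self: "br x x = 0"
    and jacobi: "br x (br y z) + br y (br z x) + br z (br x y) = 0"

locale lie_representation = lie_algebra s br + V: vector_space t
  for s :: "'k::field \<Rightarrow> 'g::ab_group_add \<Rightarrow> 'g"
    and br :: "'g \<Rightarrow> 'g \<Rightarrow> 'g"
    and t :: "'k \<Rightarrow> 'v::ab_group_add \<Rightarrow> 'v" +
  fixes act :: "'g \<Rightarrow> 'v \<Rightarrow> 'v"
  assumes bilinear_act: "bilinear_map s t t act"
    and act_br: "act (br x y) v = act x (act y v) - act y (act x v)"

locale matched_pair =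
  rho: lie_representation sg brg sh rho +
  psi: lie_representation sh brh sg psi
  for sg :: "'k::field \<Rightarrow> 'g::ab_group_add \<Rightarrow> 'g"
    and brg :: "'g \<Rightarrow> 'g \<Rightarrow> 'g"
    and sh :: "'k \<Rightarrow> 'h::ab_group_add \<Rightarrow> 'h"
    and brh :: "'h \<Rightarrow> 'h \<Rightarrow> 'h"
    and rho :: "'g \<Rightarrow> 'h \<Rightarrow> 'h"
    and psi :: "'h \<Rightarrow> 'g \<Rightarrow> 'g" +
  assumes rho_brh:
      "rho x (brh h k) = brh (rho x h) k + brh h (rho x k) + rho (psi k x) h - rho (psi h x) k"
    and psi_brg:
      "psi h (brg x y) = brg (psi h x) y + brg x (psi h y) + psi (rho y h) x - psi (rho x h) y"

locale matched_pair_representation =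
  matched_pair sg brg sh brh rho psi +
  rhoV: lie_representation sg brg sV rhoV +
  psiV: lie_representation sh brh sV psiV +
  rhoW: lie_representation sg brg sW rhoW +
  psiW: lie_representation sh brh sW psiW
  for sg :: "'k::field \<Rightarrow> 'g::ab_group_add \<Rightarrow> 'g"
    and brg :: "'g \<Rightarrow> 'g \<Rightarrow> 'g"
    and sh :: "'k \<Rightarrow> 'h::ab_group_add \<Rightarrow> 'h"
    and brh :: "'h \<Rightarrow> 'h \<Rightarrow> 'h"
    and rho :: "'g \<Rightarrow> 'h \<Rightarrow> 'h"
    and psi :: "'h \<Rightarrow> 'g \<Rightarrow> 'g"
    and sV :: "'k \<Rightarrow> 'v::ab_group_add \<Rightarrow> 'v"
    and rhoV :: "'g \<Rightarrow> 'v \<Rightarrow> 'v"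
    and psiV :: "'h \<Rightarrow> 'v \<Rightarrow> 'v"
    and sW :: "'k \<Rightarrow> 'w::ab_group_add \<Rightarrow> 'w"
    and rhoW :: "'g \<Rightarrow> 'w \<Rightarrow> 'w"
    and psiW :: "'h \<Rightarrow> 'w \<Rightarrow> 'w" +
  fixes alpha :: "'v \<Rightarrow> 'h \<Rightarrow> 'w"
    and beta :: "'w \<Rightarrow> 'g \<Rightarrow> 'v"
  assumes bilinear_alpha: "bilinear_map sV sh sW alpha"
    and bilinear_beta: "bilinear_map sW sg sV beta"
    and alpha_rhoV: "alpha (rhoV x v) h = rhoW x (alpha v h) - alpha v (rho x h)"
    and beta_psiW: "beta (psiW h w) x = psiV h (beta w x) - beta w (psi h x)"
    and rhoW_psiW:
      "rhoW x (psiW h w) =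
         psiW (rho x h) w + psiW h (rhoW x w) + alpha (beta w x) h - rhoW (psi h x) w"
    and alpha_brh:
      "alpha v (brh h k) =
         - psiW k (alpha v h) + psiW h (alpha v k) + alpha (psiV k v) h - alpha (psiV h v) k"
    and psiV_rhoV:
      "psiV h (rhoV x v) =
         rhoV (psi h x) v + rhoV x (psiV h v) + beta (alpha v h) x - psiV (rho x h) v"
    and beta_brg:
      "beta w (brg x y) =
         - rhoV y (beta w x) + rhoV x (beta w y) + beta (rhoW y w) x - beta (rhoW x w) y"

definition semidirect_bracket ::
  "('g \<Rightarrow> 'g \<Rightarrow> 'g) \<Rightarrow> ('g \<Rightarrow> 'v \<Rightarrow> 'v) \<Rightarrow> 'g \<times> 'v \<Rightarrow> 'g \<times> 'v \<Rightarrow> 'g \<times> 'v::ab_group_add" where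
  "semidirect_bracket br act = (\<lambda>(x, u) (y, v). (br x y, act x v - act y u))"

(* Both rho \<ltimes> alpha = semidirect_action rho rhoW alpha and
   psi \<ltimes> beta = semidirect_action psi psiV beta are instances. *)
definition semidirect_action ::
  "('g \<Rightarrow> 'h \<Rightarrow> 'h) \<Rightarrow> ('g \<Rightarrow> 'w \<Rightarrow> 'w) \<Rightarrow> ('v \<Rightarrow> 'h \<Rightarrow> 'w) \<Rightarrow>
   'g \<times> 'v \<Rightarrow> 'h \<times> 'w \<Rightarrow> 'h \<times> 'w::ab_group_add" where
  "semidirect_action rho rhoW alpha = (\<lambda>(x, v) (h, w). (rho x h, rhoW x w + alpha v h))"

end

(* The representation axioms are exactly the V- and W-components of the matched pair axioms for
   the semidirect products. They are invariant under exchanging (g, V, rho, alpha) with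
   (h, W, psi, beta), so it suffices to verify the identities for one of the two actions. *)
theory Submission
  imports Defs
begin

text \<open>Introduction form for bilinearity on product spaces: once the laws are equations in
  bound variables, \<open>split_paired_all\<close> breaks those variables into components.\<close>

lemma bilinear_map_iff:
  "bilinear_map s1 s2 s3 f \<longleftrightarrow>
     vector_space s1 \<and> vector_space s2 \<and> vector_space s3 \<and>
     (\<forall>x x' y. f (x + x') y = f x y + f x' y) \<and> (\<forall>c x y. f (s1 c x) y = s3 c (f x y)) \<and>
     (\<forall>x y y'. f x (y + y') = f x y + f x y') \<and> (\<forall>c x y. f x (s2 c y) = s3 c (f x y))"
  unfolding bilinear_map_def Vector_Spaces.linear_iff by auto

text \<open>Rewrite form for bilinear maps already given. The difference rules, inherited from
  linearity in each argument, serve the minus signs in brackets and commutators.\<close>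

lemma bilinear_map_simps:
  assumes "bilinear_map s1 s2 s3 f"
  shows "f (x + x') y = f x y + f x' y"
    and "f x (y + y') = f x y + f x y'"
    and "f (x - x') y = f x y - f x' y"
    and "f x (y - y') = f x y - f x y'"
    and "f (s1 c x) y = s3 c (f x y)"
    and "f x (s2 c y) = s3 c (f x y)"
proof -
  have left: "Vector_Spaces.linear s1 s3 (\<lambda>x. f x y)" for y
    using assms by (simp add: bilinear_map_def)
  have right: "Vector_Spaces.linear s2 s3 (f x)" for x
    using assms by (simp add: bilinear_map_def)
  interpret left: Vector_Spaces.linear s1 s3 "\<lambda>x. f x y" by (rule left)
  interpret right: Vector_Spaces.linear s2 s3 "f x" by (rule right)
  show "f (x + x') y = f x y + f x' y" by (rule left.add)
  show "f x (y + y') = f x y + f x y'" by (rule right.add)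
  show "f (x - x') y = f x y - f x' y" by (rule left.diff)
  show "f x (y - y') = f x y - f x y'" by (rule right.diff)
  show "f (s1 c x) y = s3 c (f x y)" by (rule left.scale)
  show "f x (s2 c y) = s3 c (f x y)" by (rule right.scale)
qed

lemma vector_space_module_prod_scale:
  assumes "vector_space s1" "vector_space s2"
  shows "vector_space (module_prod.scale s1 s2)"
proof -
  interpret s1: vector_space s1 by fact
  interpret s2: vector_space s2 by fact
  interpret vector_space_prod s1 s2 by unfold_locales
  show ?thesis by (rule p.vector_space_axioms)
qed

lemma module_prod_scale_Pair:
  assumes "vector_space s1" "vector_space s2"
  shows "module_prod.scale s1 s2 c (x, y) = (s1 c x, s2 c y)"
proof -
  interpret s1: vector_space s1 by fact
  interpret s2: vector_space s2 by fact
  interpret vector_space_prod s1 s2 by unfold_locales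
  show ?thesis by (rule scale_prod)
qed

lemma bilinear_map_semidirect_action:
  assumes "bilinear_map sg sh sh rho" and "bilinear_map sg sW sW rhoW"
    and "bilinear_map sV sh sW alpha"
  shows "bilinear_map (module_prod.scale sg sV) (module_prod.scale sh sW)
           (module_prod.scale sh sW) (semidirect_action rho rhoW alpha)"
proof -
  have vs: "vector_space sg" "vector_space sV" "vector_space sh" "vector_space sW"
    using assms by (simp_all add: bilinear_map_iff)
  \<comment> \<open>Makes \<open>algebra_simps\<close> distribute \<open>sW\<close> over the sum in
    the W-component of the action.\<close>
  interpret W: vector_space sW by (rule vs)
  show ?thesis
    unfolding bilinear_map_iff
    by (simp add: vs vector_space_module_prod_scale split_paired_all module_prod_scale_Pair
        semidirect_action_def bilinear_map_simps[OF assms(1)] bilinear_map_simps[OF assms(2)]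
        bilinear_map_simps[OF assms(3)] algebra_simps)
qed

context lie_representation
begin

text \<open>In the V-component of the Jacobi sum, \<open>act_br\<close> expands each action of a
  bracket into a commutator, and the resulting double actions cancel in pairs.\<close>

lemma lie_algebra_semidirect:
  "lie_algebra (module_prod.scale s t) (semidirect_bracket br act)"
proof -
  have vs: "vector_space s" "vector_space t"
    by unfold_locales
  note bilin = bilinear_map_simps[OF bilinear_br] bilinear_map_simps[OF bilinear_act]
  interpret P: vector_space "module_prod.scale s t"
    using vs by (rule vector_space_module_prod_scale)
  show ?thesis
  proof
    show "bilinear_map (module_prod.scale s t) (module_prod.scale s t) (module_prod.scale s t)
            (semidirect_bracket br act)"
      unfolding bilinear_map_iff
      by (simp add: P.vector_space_axioms split_paired_all module_prod_scale_Pair[OF vs]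
          semidirect_bracket_def bilin algebra_simps)
  next
    fix X :: "'g \<times> 'v"
    show "semidirect_bracket br act X X = 0"
      by (cases X) (simp add: semidirect_bracket_def br_self zero_prod_def)
  next
    fix X Y Z :: "'g \<times> 'v"
    show "semidirect_bracket br act X (semidirect_bracket br act Y Z) +
          semidirect_bracket br act Y (semidirect_bracket br act Z X) +
          semidirect_bracket br act Z (semidirect_bracket br act X Y) = 0"
      by (cases X; cases Y; cases Z)
        (simp add: semidirect_bracket_def zero_prod_def jacobi bilin act_br)
  qed
qed

end

context matched_pair_representation
begin

text \<open>The exchange sends \<open>rhoV\<close> to \<open>psiW\<close> and \<open>psiV\<close> to
  \<open>rhoW\<close>. It pairs \<open>alpha_rhoV\<close> with \<open>beta_psiW\<close>,
  \<open>rhoW_psiW\<close> with \<open>psiV_rhoV\<close>, and \<open>alpha_brh\<close> with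
  \<open>beta_brg\<close>.\<close>

lemma matched_pair_representation_swap:
  "matched_pair_representation sh brh sg brg psi rho sW psiW rhoW sV psiV rhoV beta alpha"
  by unfold_locales
    (simp_all add: rho_brh psi_brg bilinear_alpha bilinear_beta alpha_rhoV beta_psiW
      rhoW_psiW psiV_rhoV alpha_brh beta_brg)

lemma lie_representation_semidirect:
  "lie_representation (module_prod.scale sg sV) (semidirect_bracket brg rhoV)
     (module_prod.scale sh sW) (semidirect_action rho rhoW alpha)"
proof -
  interpret G: lie_algebra "module_prod.scale sg sV" "semidirect_bracket brg rhoV"
    by (rule rhoV.lie_algebra_semidirect)
  interpret H: lie_algebra "module_prod.scale sh sW" "semidirect_bracket brh psiW"
    by (rule psiW.lie_algebra_semidirect)
  show ?thesis
  proof
    show "bilinear_map (module_prod.scale sg sV) (module_prod.scale sh sW)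
            (module_prod.scale sh sW) (semidirect_action rho rhoW alpha)"
      using rho.bilinear_act rhoW.bilinear_act bilinear_alpha
      by (rule bilinear_map_semidirect_action)
  next
    fix X Y :: "'g \<times> 'v" and H :: "'h \<times> 'w"
    show "semidirect_action rho rhoW alpha (semidirect_bracket brg rhoV X Y) H =
      semidirect_action rho rhoW alpha X (semidirect_action rho rhoW alpha Y H) -
      semidirect_action rho rhoW alpha Y (semidirect_action rho rhoW alpha X H)"
      \<comment> \<open>In the W-component, the terms in the W-part of \<open>H\<close> agree
        because \<open>rhoW\<close> is a representation; those with \<open>alpha\<close> agree by
        \<open>alpha_rhoV\<close>, used once for the V-part of each of \<open>X\<close> and
        \<open>Y\<close>.\<close>
      by (cases X; cases Y; cases H)
        (simp add: semidirect_bracket_def semidirect_action_def rho.act_br rhoW.act_br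
          bilinear_map_simps[OF rhoW.bilinear_act] bilinear_map_simps[OF bilinear_alpha]
          alpha_rhoV)
  qed
qed

text \<open>The first component is \<open>rho_brh\<close>. The second splits by its dependence on
  vectors: the W-parts of \<open>H\<close> and \<open>K\<close> each give an instance of
  \<open>rhoW_psiW\<close>, with opposite signs, and the V-part of \<open>X\<close> gives
  \<open>alpha_brh\<close>.\<close>

lemma semidirect_action_bracket:
  "semidirect_action rho rhoW alpha X (semidirect_bracket brh psiW H K) =
     semidirect_bracket brh psiW (semidirect_action rho rhoW alpha X H) K +
     semidirect_bracket brh psiW H (semidirect_action rho rhoW alpha X K) +
     semidirect_action rho rhoW alpha (semidirect_action psi psiV beta K X) H -
     semidirect_action rho rhoW alpha (semidirect_action psi psiV beta H X) K"
  by (cases X; cases H; cases K)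
    (simp add: semidirect_bracket_def semidirect_action_def rho_brh rhoW_psiW alpha_brh
      bilinear_map_simps[OF rhoW.bilinear_act] bilinear_map_simps[OF psiW.bilinear_act]
      bilinear_map_simps[OF bilinear_alpha])

end

theorem theorem3p5:
  fixes sg :: "'k::field_char_0 \<Rightarrow> 'g::ab_group_add \<Rightarrow> 'g"
    and brg :: "'g \<Rightarrow> 'g \<Rightarrow> 'g"
    and sh :: "'k \<Rightarrow> 'h::ab_group_add \<Rightarrow> 'h"
    and brh :: "'h \<Rightarrow> 'h \<Rightarrow> 'h"
    and rho :: "'g \<Rightarrow> 'h \<Rightarrow> 'h"
    and psi :: "'h \<Rightarrow> 'g \<Rightarrow> 'g"
    and sV :: "'k \<Rightarrow> 'v::ab_group_add \<Rightarrow> 'v"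
    and rhoV :: "'g \<Rightarrow> 'v \<Rightarrow> 'v"
    and psiV :: "'h \<Rightarrow> 'v \<Rightarrow> 'v"
    and sW :: "'k \<Rightarrow> 'w::ab_group_add \<Rightarrow> 'w"
    and rhoW :: "'g \<Rightarrow> 'w \<Rightarrow> 'w"
    and psiW :: "'h \<Rightarrow> 'w \<Rightarrow> 'w"
    and alpha :: "'v \<Rightarrow> 'h \<Rightarrow> 'w"
    and beta :: "'w \<Rightarrow> 'g \<Rightarrow> 'v"
  assumes "matched_pair sg brg sh brh rho psi"
    and "matched_pair_representation sg brg sh brh rho psi
           sV rhoV psiV sW rhoW psiW alpha beta"
  shows "matched_pair
           (module_prod.scale sg sV) (semidirect_bracket brg rhoV)
           (module_prod.scale sh sW) (semidirect_bracket brh psiW)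
           (semidirect_action rho rhoW alpha) (semidirect_action psi psiV beta)"
proof -
  interpret R: matched_pair_representation sg brg sh brh rho psi
      sV rhoV psiV sW rhoW psiW alpha beta
    by fact
  interpret R': matched_pair_representation sh brh sg brg psi rho
      sW psiW rhoW sV psiV rhoV beta alpha
    by (rule R.matched_pair_representation_swap)
  show ?thesis
    \<comment> \<open>Under the swap, \<open>semidirect_action rho rhoW alpha\<close> becomes
      \<open>semidirect_action psi psiV beta\<close>, so the facts from \<open>R'\<close> are the
      conditions on the second action.\<close>
    using R.lie_representation_semidirect R'.lie_representation_semidirect
    by (intro matched_pair.intro matched_pair_axioms.intro
        R.semidirect_action_bracket R'.semidirect_action_bracket)
qed

end
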